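(* Let $Q$ be a Jordan loop and $c\in Q$. Then $c^n$ is well-defined whenever $1\le n\le 5$.
   Context: A loop is a quasigroup (a magma in which $ax=b$ and $ya=b$ have unique solutions for all $a,b$) with a neutral element. A loop is Jordan if it is commutative and satisfies $x^2(yx)=(x^2y)x$. For $n>0$, $c^n$ is well-defined if the value of the product $c\cdots c$ of $n$ factors $c$ does not depend on how the factors are parenthesized. *)

theory Defs
  imports "HOL-Algebra.Group"
begin

locale magma =
  fixes Q (structure)
  assumes m_closed [intro, simp]:
    "\<lbrakk>x \<in> carrier Q; y \<in> carrier Q\<rbrakk> \<Longrightarrow> x \<otimes> y \<in> carrier Q"

(* The field "one" of the record Q is unconstrained here; it becomes relevant in "loop". *)
locale quasigroup = magma +
  assumes left_div:
    "\<lbrakk>a \<in> carrier Q; b \<in> carrier Q\<rbrakk> \<Longrightarrow> \<exists>!x. x \<in> carrier Q \<and> a \<otimes> x = b"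
  and right_div:
    "\<lbrakk>a \<in> carrier Q; b \<in> carrier Q\<rbrakk> \<Longrightarrow> \<exists>!y. y \<in> carrier Q \<and> y \<otimes> a = b"

locale loop = quasigroup +
  assumes one_closed [intro, simp]: "\<one> \<in> carrier Q"
  and l_one [simp]: "x \<in> carrier Q \<Longrightarrow> \<one> \<otimes> x = x"
  and r_one [simp]: "x \<in> carrier Q \<Longrightarrow> x \<otimes> \<one> = x"

locale jordan_loop = loop +
  assumes m_comm: "\<lbrakk>x \<in> carrier Q; y \<in> carrier Q\<rbrakk> \<Longrightarrow> x \<otimes> y = y \<otimes> x"
  and jordan: "\<lbrakk>x \<in> carrier Q; y \<in> carrier Q\<rbrakk>
    \<Longrightarrow> (x \<otimes> x) \<otimes> (y \<otimes> x) = ((x \<otimes> x) \<otimes> y) \<otimes> x"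

(* Full parenthesizations of a product of n > 0 factors are the full binary trees with n leaves. *)
datatype parenthesization = Factor | Product parenthesization parenthesization

fun num_factors :: "parenthesization \<Rightarrow> nat" where
  "num_factors Factor = 1"
| "num_factors (Product s t) = num_factors s + num_factors t"

fun paren_power :: "('a, 'b) monoid_scheme \<Rightarrow> 'a \<Rightarrow> parenthesization \<Rightarrow> 'a" where
  "paren_power Q c Factor = c"
| "paren_power Q c (Product s t) = paren_power Q c s \<otimes>\<^bsub>Q\<^esub> paren_power Q c t"

(* Meaningful for n > 0 only: there is no parenthesization with 0 factors. *)
definition power_well_defined :: "('a, 'b) monoid_scheme \<Rightarrow> 'a \<Rightarrow> nat \<Rightarrow> bool" where
  "power_well_defined Q c n \<longleftrightarrow>
    (\<forall>s t. num_factors s = n \<longrightarrow> num_factors t = n \<longrightarrow> paren_power Q c s = paren_power Q c t)"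

end

theory Submission
  imports Defs
begin

text \<open>
  Put \<open>x = c\<close> and \<open>y = c\<^sup>k\<close> in the Jordan identity: then \<open>c\<^sup>2c\<^sup>k\<^sup>+\<^sup>1 = (c\<^sup>2c\<^sup>k)c\<close>. By induction on \<open>k\<close>,
  multiplication by \<open>c\<^sup>2\<close> raises the exponent of every power of \<open>c\<close> by two. In a product \<open>c\<^sup>ic\<^sup>j\<close>
  with \<open>i + j \<le> 5\<close> one of the exponents is at most two, so exponents add up in such products.
\<close>

lemma nat_pow_0:
  fixes Q (structure)
  shows "x [^] (0::nat) = \<one>"
  by (simp add: nat_pow_def)

lemma nat_pow_Suc:
  fixes Q (structure)
  shows "x [^] Suc n = x [^] n \<otimes> x"
  by (simp add: nat_pow_def)

context loop
begin

lemma nat_pow_closed: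
  assumes "x \<in> carrier Q"
  shows "x [^] (n::nat) \<in> carrier Q"
  using assms by (induction n) (simp_all add: nat_pow_0 nat_pow_Suc)

lemma nat_pow_1:
  assumes "x \<in> carrier Q"
  shows "x [^] (1::nat) = x"
  using assms by (simp add: nat_pow_0 nat_pow_Suc)

lemma nat_pow_2:
  assumes "x \<in> carrier Q"
  shows "x [^] (2::nat) = x \<otimes> x"
  using assms by (simp add: numeral_2_eq_2 nat_pow_0 nat_pow_Suc)

lemma paren_power_eq_nat_pow:
  assumes c: "c \<in> carrier Q"
    and pow_mult: "\<And>i j::nat. i + j \<le> n \<Longrightarrow> c [^] i \<otimes> c [^] j = c [^] (i + j)"
    and "num_factors t \<le> n"
  shows "paren_power Q c t = c [^] num_factors t"
  using \<open>num_factors t \<le> n\<close>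
proof (induction t)
  case Factor
  show ?case using nat_pow_1[OF c] by simp
next
  case (Product s t)
  then show ?case using pow_mult by simp
qed

lemma power_well_defined_if_nat_pow_mult:
  assumes "c \<in> carrier Q"
    and "\<And>i j::nat. i + j \<le> n \<Longrightarrow> c [^] i \<otimes> c [^] j = c [^] (i + j)"
  shows "power_well_defined Q c n"
  using paren_power_eq_nat_pow[OF assms] by (simp add: power_well_defined_def)

end

context jordan_loop
begin

lemma nat_pow_2_mult:
  fixes n :: nat
  assumes x: "x \<in> carrier Q"
  shows "x [^] (2::nat) \<otimes> x [^] n = x [^] (2 + n)"
proof (induction n)
  case 0
  show ?case using nat_pow_closed[OF x] by (simp add: nat_pow_0)
next
  case (Suc n)
  have "x [^] (2::nat) \<otimes> x [^] Suc n = (x [^] (2::nat) \<otimes> x [^] n) \<otimes> x"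
    using jordan[OF x nat_pow_closed[OF x]] by (simp add: nat_pow_2[OF x] nat_pow_Suc)
  also have "\<dots> = x [^] (2 + Suc n)"
    by (simp add: Suc.IH nat_pow_Suc)
  finally show ?case .
qed

lemma nat_pow_mult_if_le_2:
  fixes i j :: nat
  assumes x: "x \<in> carrier Q" and "i \<le> 2"
  shows "x [^] i \<otimes> x [^] j = x [^] (i + j)"
proof -
  consider "i = 0" | "i = 1" | "i = 2"
    using \<open>i \<le> 2\<close> by linarith
  then show ?thesis
  proof cases
    assume "i = 0"
    then show ?thesis using nat_pow_closed[OF x] by (simp add: nat_pow_0)
  next
    assume "i = 1"
    then show ?thesis
      using m_comm[OF x nat_pow_closed[OF x]] nat_pow_1[OF x] by (simp add: nat_pow_Suc)
  next
    assume "i = 2"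
    then show ?thesis using nat_pow_2_mult[OF x, of j] by simp
  qed
qed

lemma nat_pow_mult_if_add_le_5:
  fixes i j :: nat
  assumes x: "x \<in> carrier Q" and "i + j \<le> 5"
  shows "x [^] i \<otimes> x [^] j = x [^] (i + j)"
proof -
  consider "i \<le> 2" | "j \<le> 2"
    using \<open>i + j \<le> 5\<close> by linarith
  then show ?thesis
  proof cases
    assume "i \<le> 2"
    then show ?thesis by (rule nat_pow_mult_if_le_2[OF x])
  next
    assume "j \<le> 2"
    have "x [^] i \<otimes> x [^] j = x [^] j \<otimes> x [^] i"
      by (intro m_comm nat_pow_closed x)
    also have "\<dots> = x [^] (i + j)"
      using nat_pow_mult_if_le_2[OF x \<open>j \<le> 2\<close>] by (simp add: add.commute)
    finally show ?thesis .
  qed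
qed

end

theorem lemma5p2:
  fixes Q :: "('a, 'b) monoid_scheme" and c :: 'a and n :: nat
  assumes "jordan_loop Q"
    and "c \<in> carrier Q"
    and "1 \<le> n" and "n \<le> 5"
  shows "power_well_defined Q c n"
proof -
  interpret jordan_loop Q by fact
  show ?thesis
  proof (rule power_well_defined_if_nat_pow_mult)
    show "c \<in> carrier Q" by fact
    show "c [^]\<^bsub>Q\<^esub> i \<otimes>\<^bsub>Q\<^esub> c [^]\<^bsub>Q\<^esub> j = c [^]\<^bsub>Q\<^esub> (i + j)" if "i + j \<le> n" for i j :: nat
      using that \<open>n \<le> 5\<close> by (intro nat_pow_mult_if_add_le_5[OF \<open>c \<in> carrier Q\<close>]) linarith
  qed
qed

end
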